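(* Consider the time-varying semidefinite program (TV-SDP) $$\sup_{x\in \mathbf{L}^n}\ \int_0^1\langle c(t),x(t)\rangle\,dt\quad\text{subject to}\quad Fx(t)\succeq 0\ \text{ for almost every } t\in[0,1],$$ with polynomial data $c, A_0,\dots,A_n,D_1,\dots,D_n$, and let $\mathrm{opt}$ (possibly $+\infty$) be its optimal value. Suppose that the TV-SDP is strictly feasible, i.e. there exist $x^s\in\mathbf{L}^n$ and $\varepsilon>0$ such that $Fx^s(t)\succeq\varepsilon I$ for almost every $t\in[0,1]$. Then there exists a sequence $\{x^k\}$ of feasible solutions of the TV-SDP, each of whose components is a polynomial in $t$, such that $$\int_0^1\langle c(t),x^k(t)\rangle\,dt\to\mathrm{opt}\quad\text{as }k\to\infty.$$
   Context: $\mathbf{L}^n$ is the set of measurable functions $x:[0,1]\to\mathbb{R}^n$ with $\sup_{t\in[0,1],\,i}|x_i(t)|<\infty$. The data are: $c$, a vector of $n$ univariate real polynomials; $A_0,\dots,A_n$, symmetric $m\times m$ matrices whose entries are real polynomials in $t$; $D_1,\dots,D_n$, symmetric $m\times m$ matrices whose entries are real polynomials in $(t,s)$. For $x\in\mathbf{L}^n$, $$Fx(t)=A_0(t)+\sum_{i=1}^n x_i(t)A_i(t)+\sum_{i=1}^n\int_0^t x_i(s)D_i(t,s)\,ds.$$ For symmetric matrices, $M\succeq N$ means that $M-N$ is positive semidefinite; $I$ is the identity matrix. "Almost every" refers to Lebesgue measure. A feasible solution is an $x\in\mathbf{L}^n$ with $Fx(t)\succeq0$ for almost every $t\in[0,1]$.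 $\langle\cdot,\cdot\rangle$ is the standard inner product of $\mathbb{R}^n$. *)

theory Defs
  imports "HOL-Analysis.Analysis" "HOL-Computational_Algebra.Polynomial"
begin

definition eval_mat :: "real poly^'m^'m \<Rightarrow> real \<Rightarrow> real^'m^'m" where
  "eval_mat M t = (\<chi> i j. poly (M $ i $ j) t)"

(* A polynomial in (t,s) is an element of R[t][s]: the outer variable is s, the coefficients are
   polynomials in t. *)
definition eval_mat2 :: "real poly poly^'m^'m \<Rightarrow> real \<Rightarrow> real \<Rightarrow> real^'m^'m" where
  "eval_mat2 M t s = (\<chi> i j. poly (poly (M $ i $ j) [:s:]) t)"

definition psd :: "real^'m^'m \<Rightarrow> bool" where
  "psd M \<longleftrightarrow> transpose M = M \<and> (\<forall>v. 0 \<le> v \<bullet> (M *v v))"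

definition loewner_ge :: "real^'m^'m \<Rightarrow> real^'m^'m \<Rightarrow> bool" (infix "\<succeq>" 50) where
  "M \<succeq> N \<longleftrightarrow> psd (M - N)"

(* Only the values on [0,1] matter; the functions are arbitrary elsewhere. *)
definition Linf :: "(real \<Rightarrow> real^'n) set" where
  "Linf = {x. x \<in> borel_measurable (lebesgue_on {0..1}) \<and>
              (\<exists>B. \<forall>t\<in>{0..1}. \<forall>i. \<bar>x t $ i\<bar> \<le> B)}"

definition F :: "real poly^'m^'m \<Rightarrow> ('n::finite \<Rightarrow> real poly^'m^'m) \<Rightarrow> ('n \<Rightarrow> real poly poly^'m^'m)
    \<Rightarrow> (real \<Rightarrow> real^'n) \<Rightarrow> real \<Rightarrow> real^'m^'m" where
  "F A0 A D x t = eval_mat A0 t + (\<Sum>i\<in>UNIV. x t $ i *\<^sub>R eval_mat (A i) t)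
     + (\<Sum>i\<in>UNIV. LINT s:{0..t}|lebesgue. x s $ i *\<^sub>R eval_mat2 (D i) t s)"

definition feasible :: "real poly^'m^'m \<Rightarrow> ('n::finite \<Rightarrow> real poly^'m^'m)
    \<Rightarrow> ('n \<Rightarrow> real poly poly^'m^'m) \<Rightarrow> (real \<Rightarrow> real^'n) set" where
  "feasible A0 A D = {x \<in> Linf. AE t in lebesgue_on {0..1}. F A0 A D x t \<succeq> 0}"

definition strictly_feasible :: "real poly^'m^'m \<Rightarrow> ('n::finite \<Rightarrow> real poly^'m^'m)
    \<Rightarrow> ('n \<Rightarrow> real poly poly^'m^'m) \<Rightarrow> bool" where
  "strictly_feasible A0 A D \<longleftrightarrow>
     (\<exists>x\<in>Linf. \<exists>\<epsilon>>0. AE t in lebesgue_on {0..1}. F A0 A D x t \<succeq> \<epsilon> *\<^sub>R mat 1)"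

definition objective :: "real poly^'n \<Rightarrow> (real \<Rightarrow> real^'n) \<Rightarrow> real" where
  "objective c x = (LINT t:{0..1}|lebesgue. (\<chi> i. poly (c $ i) t) \<bullet> x t)"

definition opt :: "real poly^'n \<Rightarrow> real poly^'m^'m \<Rightarrow> ('n::finite \<Rightarrow> real poly^'m^'m)
    \<Rightarrow> ('n \<Rightarrow> real poly poly^'m^'m) \<Rightarrow> ereal" where
  "opt c A0 A D = (SUP x\<in>feasible A0 A D. ereal (objective c x))"

end

theory Submission
  imports Defs
begin

text \<open>
A bounded measurable control cannot in general be approximated uniformly by polynomials, while the
constraint is pointwise in \<open>t\<close>, so approximating \<open>x\<close> in \<open>L\<^sup>1\<close> alone could violate it on a small set. The
remedy is to approximate by averaging: the constraint on the value \<open>x t\<close> is affine with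
coefficients that are continuous in \<open>t\<close>, so an average of nearby values of \<open>x\<close> nearly satisfies it
whenever almost all of these values do.

The averages are taken with the Kantorovich operators \<open>K\<^sub>n\<close>: the value \<open>K\<^sub>n x t\<close> is the sum of the
means of \<open>x\<close> over the \<open>n + 1\<close> equal subintervals of \<open>[0,1]\<close>, weighted by the Bernstein
polynomials of degree \<open>n\<close> at \<open>t\<close>. They produce polynomials directly, are positive, and need no
special treatment of the endpoints. Three facts about them carry the proof. A lower bound that holds
almost everywhere for \<open>f\<close> holds everywhere for \<open>K\<^sub>n f\<close> (\<open>kantorovich_lower_bound_AE\<close>). For
continuous \<open>a\<close>, the difference \<open>K\<^sub>n (x a) - (K\<^sub>n x) a\<close> tends to 0 uniformly
(\<open>kantorovich_localizes\<close>). And \<open>K\<^sub>n x\<close> tends to \<open>x\<close> in \<open>L\<^sup>1\<close>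
(\<open>kantorovich_L1_tendsto\<close>), which makes the integral term of \<open>F\<close> converge uniformly and the
objective converge. Together they show that \<open>F (K\<^sub>n x) - K\<^sub>n (F x)\<close> tends to 0 uniformly
(\<open>F_entry_kantorovich_vec\<close>). Hence if \<open>F x \<succeq> \<epsilon> I\<close> almost everywhere with \<open>\<epsilon> > 0\<close>, then for large
\<open>n\<close> the polynomial control \<open>K\<^sub>n x\<close> satisfies the constraint at every point of \<open>[0,1]\<close>
(\<open>polynomial_strict_approximation\<close>).

Strict feasibility provides the margin: a convex combination of a feasible control that gives
a small weight to the strictly feasible one has a positive margin, because \<open>F\<close> is affine, and nearly the
same objective. So the polynomial feasible controls have the same supremum as all feasible ones.
\<close>

section \<open>Bounded measurable functions on the unit interval\<close>

text \<open>The unit interval is built in, because every component of a control and every entry of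
\<open>F x\<close> is needed there only; such functions are integrable on every subinterval.\<close>
definition bounded_measurable :: "(real \<Rightarrow> real) \<Rightarrow> bool" where
  "bounded_measurable f \<longleftrightarrow>
     f \<in> borel_measurable (lebesgue_on {0..1}) \<and> (\<exists>B. \<forall>t\<in>{0..1}. \<bar>f t\<bar> \<le> B)"

lemma bounded_measurable_boundE:
  assumes "bounded_measurable f"
  obtains B where "B > 0" "\<And>t. t \<in> {0..1} \<Longrightarrow> \<bar>f t\<bar> \<le> B"
proof -
  obtain B where "\<forall>t\<in>{0..1}. \<bar>f t\<bar> \<le> B" using assms by (auto simp: bounded_measurable_def)
  then show ?thesis using that[of "max B 1"] by fastforce
qed

lemma bounded_measurable_continuous:
  assumes "continuous_on {0..1} f"
  shows "bounded_measurable f"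
proof -
  have "f \<in> borel_measurable (lebesgue_on {0..1})"
    by (rule continuous_imp_measurable_on_sets_lebesgue[OF assms]) auto
  moreover have "bounded (f ` {0..1})"
    using assms compact_continuous_image compact_imp_bounded by blast
  ultimately show ?thesis
    by (auto simp: bounded_measurable_def bounded_iff)
qed

lemma bounded_measurable_mult:
  assumes "bounded_measurable f" "bounded_measurable g"
  shows "bounded_measurable (\<lambda>t. f t * g t)"
proof -
  obtain B C where "B > 0" "\<And>t. t \<in> {0..1} \<Longrightarrow> \<bar>f t\<bar> \<le> B"
    and "C > 0" "\<And>t. t \<in> {0..1} \<Longrightarrow> \<bar>g t\<bar> \<le> C"
    using assms by (metis bounded_measurable_boundE)
  then have "\<forall>t\<in>{0..1}. \<bar>f t * g t\<bar> \<le> B * C"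
    by (auto simp: abs_mult intro!: mult_mono)
  then show ?thesis using assms
    unfolding bounded_measurable_def by (blast intro: borel_measurable_times)
qed

lemma bounded_measurable_add:
  assumes "bounded_measurable f" "bounded_measurable g"
  shows "bounded_measurable (\<lambda>t. f t + g t)"
proof -
  obtain B C where "B > 0" "\<And>t. t \<in> {0..1} \<Longrightarrow> \<bar>f t\<bar> \<le> B"
    and "C > 0" "\<And>t. t \<in> {0..1} \<Longrightarrow> \<bar>g t\<bar> \<le> C"
    using assms by (metis bounded_measurable_boundE)
  then have "\<forall>t\<in>{0..1}. \<bar>f t + g t\<bar> \<le> B + C"
    by (meson abs_triangle_ineq add_mono order_trans)
  then show ?thesis using assms
    unfolding bounded_measurable_def by (blast intro: borel_measurable_add)
qed

lemma bounded_measurable_const: "bounded_measurable (\<lambda>t. c)"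
  by (simp add: bounded_measurable_continuous)

lemma bounded_measurable_cmult:
  "bounded_measurable f \<Longrightarrow> bounded_measurable (\<lambda>t. c * f t)"
  by (simp add: bounded_measurable_mult bounded_measurable_const)

lemma bounded_measurable_diff:
  assumes "bounded_measurable f" "bounded_measurable g"
  shows "bounded_measurable (\<lambda>t. f t - g t)"
  using bounded_measurable_add[OF assms(1) bounded_measurable_cmult[OF assms(2), of "-1"]] by simp

lemma bounded_measurable_sum:
  assumes "\<And>i. i \<in> I \<Longrightarrow> bounded_measurable (f i)"
  shows "bounded_measurable (\<lambda>t. \<Sum>i\<in>I. f i t)"
  using assms
  by (induction I rule: infinite_finite_induct)
     (auto intro: bounded_measurable_add bounded_measurable_const)

lemma bounded_measurable_abs: "bounded_measurable f \<Longrightarrow> bounded_measurable (\<lambda>t. \<bar>f t\<bar>)"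
  by (auto simp: bounded_measurable_def)

lemmas bounded_measurable_intros =
  bounded_measurable_mult bounded_measurable_add bounded_measurable_const
  bounded_measurable_diff bounded_measurable_sum bounded_measurable_abs

lemma bounded_measurable_absolutely_integrable:
  assumes "bounded_measurable f" "{a..b} \<subseteq> {0..1}"
  shows "f absolutely_integrable_on {a..b}"
proof -
  obtain B where B: "\<And>t. t \<in> {0..1} \<Longrightarrow> \<bar>f t\<bar> \<le> B"
    using bounded_measurable_boundE[OF assms(1)] by blast
  have "f absolutely_integrable_on {0..1}"
    using assms(1) B
    by (intro measurable_bounded_by_integrable_imp_absolutely_integrable[where g = "\<lambda>_. B"])
       (auto simp: bounded_measurable_def)
  then show ?thesis
    using assms(2) set_integrable_subset by fastforce
qed

lemma bounded_measurable_integrable: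
  assumes "bounded_measurable f" "{a..b} \<subseteq> {0..1}"
  shows "f integrable_on {a..b}"
  using bounded_measurable_absolutely_integrable[OF assms] set_lebesgue_integral_eq_integral(1) by blast

lemma AE_lebesgue_on_negligibleE:
  assumes "AE t in lebesgue_on S. P t" "S \<in> sets lebesgue"
  obtains N where "negligible N" "\<And>t. t \<in> S - N \<Longrightarrow> P t"
proof -
  have "AE t in lebesgue. t \<in> S \<longrightarrow> P t"
    using assms by (simp add: AE_restrict_space_iff)
  then obtain N where "N \<in> null_sets lebesgue" "{t. \<not> (t \<in> S \<longrightarrow> P t)} \<subseteq> N"
    by (auto simp: eventually_ae_filter)
  then show ?thesis using that[of N] by (auto simp: negligible_iff_null_sets)
qed

text \<open>This is how a constraint that holds only almost everywhere enters: an average does not see null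
sets.\<close>
lemma integral_lower_bound_AE:
  fixes f :: "real \<Rightarrow> real"
  assumes f: "bounded_measurable f" and sub: "{a..b} \<subseteq> {0..1}" and "a \<le> b"
    and AE: "AE t in lebesgue_on {0..1}. c \<le> f t"
  shows "c * (b - a) \<le> integral {a..b} f"
proof -
  obtain N where N: "negligible N" "\<And>t. t \<in> {0..1} - N \<Longrightarrow> c \<le> f t"
    using AE_lebesgue_on_negligibleE[OF AE] by auto
  \<comment> \<open>Replacing \<open>f\<close> by \<open>max c f\<close> changes it on a null set and makes the bound hold everywhere.\<close>
  have eq: "t \<in> {a..b} - N \<Longrightarrow> f t = max c (f t)" for t
    using N(2) sub by fastforce
  have int: "f integrable_on {a..b}"
    by (rule bounded_measurable_integrable[OF f sub])
  have int': "(\<lambda>t. max c (f t)) integrable_on {a..b}"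
    by (rule integrable_spike[OF int N(1)]) (use eq in simp)
  have "integral {a..b} (\<lambda>t. c) \<le> integral {a..b} (\<lambda>t. max c (f t))"
    by (rule integral_le) (use int' in auto)
  also have "\<dots> = integral {a..b} f"
    by (rule integral_spike[OF N(1)]) (use eq in simp)
  finally show ?thesis using \<open>a \<le> b\<close> by (simp add: mult.commute)
qed

section \<open>The Kantorovich operators\<close>

text \<open>For \<open>k \<le> n\<close> the cells divide \<open>[0,1]\<close> into \<open>n + 1\<close> equal parts, one for each Bernstein
polynomial of degree \<open>n\<close>.\<close>
definition cell :: "nat \<Rightarrow> nat \<Rightarrow> real set" where
  "cell n k = {real k / (real n + 1)..(real k + 1) / (real n + 1)}"

definition cell_mean :: "nat \<Rightarrow> (real \<Rightarrow> real) \<Rightarrow> nat \<Rightarrow> real" where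
  "cell_mean n f k = (real n + 1) * integral (cell n k) f"

text \<open>The Kantorovich variant of the Bernstein operator: point values, which mean nothing for a function
that matters only up to null sets, are replaced by means over cells.\<close>
definition kantorovich :: "nat \<Rightarrow> (real \<Rightarrow> real) \<Rightarrow> real \<Rightarrow> real" where
  "kantorovich n f t = (\<Sum>k\<le>n. Bernstein n k t * cell_mean n f k)"

lemma cell_subset: "k \<le> n \<Longrightarrow> cell n k \<subseteq> {0..1}"
  by (auto simp: cell_def divide_simps)

lemma cell_integrable: "bounded_measurable f \<Longrightarrow> k \<le> n \<Longrightarrow> f integrable_on cell n k"
  using bounded_measurable_integrable cell_subset unfolding cell_def by blast

lemma cell_mean_add:
  assumes "bounded_measurable f" "bounded_measurable g" "k \<le> n"
  shows "cell_mean n (\<lambda>t. f t + g t) k = cell_mean n f k + cell_mean n g k"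
  using cell_integrable assms by (simp add: cell_mean_def Henstock_Kurzweil_Integration.integral_add distrib_left)

lemma cell_mean_cmult: "cell_mean n (\<lambda>t. c * f t) k = c * cell_mean n f k"
  by (simp add: cell_mean_def)

lemma cell_mean_const: "cell_mean n (\<lambda>t. c) k = c"
proof -
  have "real k / (real n + 1) \<le> (real k + 1) / (real n + 1)" by (simp add: divide_right_mono)
  then show ?thesis by (simp add: cell_mean_def cell_def field_simps)
qed

lemma cell_mean_lower_bound_AE:
  assumes "bounded_measurable f" "k \<le> n" "AE t in lebesgue_on {0..1}. c \<le> f t"
  shows "c \<le> cell_mean n f k"
proof -
  have "c * ((real k + 1) / (real n + 1) - real k / (real n + 1)) \<le> integral (cell n k) f"
    unfolding cell_def
    by (rule integral_lower_bound_AE)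
       (use assms cell_subset[of k n] in \<open>auto simp: cell_def divide_right_mono\<close>)
  then show ?thesis by (simp add: cell_mean_def field_simps)
qed

lemma cell_mean_abs_bound:
  assumes f: "bounded_measurable f" and k: "k \<le> n" and b: "\<And>s. s \<in> cell n k \<Longrightarrow> \<bar>f s\<bar> \<le> b"
  shows "\<bar>cell_mean n f k\<bar> \<le> b"
proof -
  have "norm (integral (cell n k) f) \<le> integral (cell n k) (\<lambda>_. b)"
    using b by (intro integral_norm_bound_integral cell_integrable f k bounded_measurable_const) auto
  then have "\<bar>cell_mean n f k\<bar> \<le> cell_mean n (\<lambda>_. b) k"
    by (simp add: cell_mean_def abs_mult mult_left_mono)
  then show ?thesis by (simp add: cell_mean_const)
qed

lemma kantorovich_add:
  assumes "bounded_measurable f" "bounded_measurable g"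
  shows "kantorovich n (\<lambda>t. f t + g t) t = kantorovich n f t + kantorovich n g t"
  using assms by (simp add: kantorovich_def cell_mean_add distrib_left sum.distrib)

lemma kantorovich_cmult: "kantorovich n (\<lambda>t. c * f t) t = c * kantorovich n f t"
  by (simp add: kantorovich_def cell_mean_cmult sum_distrib_left mult_ac)

lemma kantorovich_const: "kantorovich n (\<lambda>t. c) t = c"
  by (simp add: kantorovich_def cell_mean_const flip: sum_distrib_right)

lemma kantorovich_diff:
  assumes "bounded_measurable f" "bounded_measurable g"
  shows "kantorovich n (\<lambda>t. f t - g t) t = kantorovich n f t - kantorovich n g t"
  using kantorovich_add[OF assms(1) bounded_measurable_cmult[OF assms(2), of "-1"], of n t]
    kantorovich_cmult[of n "-1" g t]
  by simp

lemma kantorovich_sum: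
  assumes "finite I" "\<And>i. i \<in> I \<Longrightarrow> bounded_measurable (f i)"
  shows "kantorovich n (\<lambda>t. \<Sum>i\<in>I. f i t) t = (\<Sum>i\<in>I. kantorovich n (f i) t)"
  using assms
  by (induction I)
     (auto simp: kantorovich_add bounded_measurable_sum kantorovich_const)

text \<open>Positivity of the operator upgrades an almost everywhere bound to a bound at every point, since the
values of \<open>kantorovich n f\<close> on \<open>[0,1]\<close> are convex combinations of means.\<close>
lemma kantorovich_lower_bound_AE:
  assumes "bounded_measurable f" "AE t in lebesgue_on {0..1}. c \<le> f t" "t \<in> {0..1}"
  shows "c \<le> kantorovich n f t"
proof -
  have "c = (\<Sum>k\<le>n. Bernstein n k t * c)" by (simp flip: sum_distrib_right)
  also have "\<dots> \<le> kantorovich n f t"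
    unfolding kantorovich_def using assms
    by (intro sum_mono mult_left_mono cell_mean_lower_bound_AE Bernstein_nonneg) auto
  finally show ?thesis .
qed

lemma kantorovich_polynomial: "\<exists>p. \<forall>t. kantorovich n f t = poly p t"
proof
  let ?p = "\<Sum>k\<le>n. smult (cell_mean n f k * real (n choose k)) ([:0, 1:] ^ k * [:1, -1:] ^ (n - k))"
  show "\<forall>t. kantorovich n f t = poly ?p t"
    by (simp add: kantorovich_def Bernstein_def poly_sum mult_ac)
qed

lemma continuous_on_kantorovich: "continuous_on S (kantorovich n f)"
proof -
  obtain p where "kantorovich n f = poly p" using kantorovich_polynomial by (metis ext)
  then show ?thesis by (simp add: continuous_on_poly continuous_on_id)
qed

lemma bounded_measurable_kantorovich: "bounded_measurable (kantorovich n f)"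
  by (simp add: bounded_measurable_continuous continuous_on_kantorovich)

section \<open>Localization and uniform convergence\<close>

text \<open>The variance of the binomial distribution with parameters \<open>n\<close> and \<open>t\<close>, divided by \<open>n\<^sup>2\<close>: the weights
concentrate near \<open>k/n = t\<close>.\<close>
lemma Bernstein_variance:
  assumes "n > 0"
  shows "(\<Sum>k\<le>n. Bernstein n k t * (real k / real n - t)\<^sup>2) = t * (1 - t) / real n"
proof -
  have "Bernstein n k t * (real k / real n - t)\<^sup>2 =
      (real k * (real k - 1) * Bernstein n k t + (1 - 2 * real n * t) * (real k * Bernstein n k t)
        + (real n * t)\<^sup>2 * Bernstein n k t) / (real n)\<^sup>2" for k
    using assms by (simp add: field_simps power2_eq_square)
  then have "(\<Sum>k\<le>n. Bernstein n k t * (real k / real n - t)\<^sup>2) =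
      (real n * (real n - 1) * t\<^sup>2 + (1 - 2 * real n * t) * (real n * t) + (real n * t)\<^sup>2) / (real n)\<^sup>2"
    by (simp add: sum.distrib flip: sum_divide_distrib sum_distrib_left)
  also have "\<dots> = t * (1 - t) / real n"
    using assms by (simp add: field_simps power2_eq_square)
  finally show ?thesis .
qed

text \<open>The node \<open>k/n\<close> lies in the cell of index \<open>k\<close>, so averaging over cells costs only a further
\<open>O(1/n)\<close> in the concentration estimate.\<close>
lemma cell_dist_square_le:
  assumes "n > 0" "k \<le> n" "s \<in> cell n k"
  shows "(s - t)\<^sup>2 \<le> 2 / real n + 2 * (real k / real n - t)\<^sup>2"
proof -
  have "real k \<le> real n" using assms by simp
  then have "real k / (real n + 1) \<le> real k / real n" "real k / real n \<le> (real k + 1) / (real n + 1)"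
    using assms(1) by (auto simp: field_simps)
  moreover have "(real k + 1) / (real n + 1) - real k / (real n + 1) \<le> 1 / real n"
    using assms(1) by (simp add: field_simps)
  ultimately have "\<bar>s - real k / real n\<bar> \<le> 1 / real n"
    using assms(3) unfolding cell_def by (simp add: abs_le_iff)
  then have "(s - real k / real n)\<^sup>2 \<le> (1 / real n)\<^sup>2"
    by (metis abs_ge_zero power2_abs power_mono)
  also have "\<dots> \<le> 1 / real n" using assms(1) by (simp add: field_simps power2_eq_square)
  finally have "(s - real k / real n)\<^sup>2 \<le> 1 / real n" .
  moreover have "(s - t)\<^sup>2 \<le> 2 * (s - real k / real n)\<^sup>2 + 2 * (real k / real n - t)\<^sup>2"
  proof -
    have "(s - t)\<^sup>2 \<le> 2 * (s - u)\<^sup>2 + 2 * (u - t)\<^sup>2" for u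
      using zero_le_power2[of "(s - u) - (u - t)"] by (simp add: power2_eq_square algebra_simps)
    then show ?thesis .
  qed
  ultimately show ?thesis by linarith
qed

text \<open>A modulus of continuity in the form that combines with a variance bound: nearby points are handled
by uniform continuity, distant ones by boundedness.\<close>
lemma continuous_quadratic_modulus:
  fixes a :: "real \<Rightarrow> real"
  assumes "continuous_on {0..1} a" "e > 0"
  obtains C where "C \<ge> 0"
    "\<And>s t. s \<in> {0..1} \<Longrightarrow> t \<in> {0..1} \<Longrightarrow> \<bar>a s - a t\<bar> \<le> e + C * (s - t)\<^sup>2"
proof -
  obtain M where M: "M > 0" "\<And>t. t \<in> {0..1} \<Longrightarrow> \<bar>a t\<bar> \<le> M"
    using bounded_measurable_boundE[OF bounded_measurable_continuous[OF assms(1)]] by blast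
  obtain d where d: "d > 0" "\<And>s t. s \<in> {0..1} \<Longrightarrow> t \<in> {0..1} \<Longrightarrow> \<bar>s - t\<bar> < d \<Longrightarrow> \<bar>a s - a t\<bar> < e"
    using compact_uniformly_continuous[OF assms(1)] \<open>e > 0\<close>
    unfolding uniformly_continuous_on_def dist_real_def by (metis compact_Icc)
  have "\<bar>a s - a t\<bar> \<le> e + 2 * M / d\<^sup>2 * (s - t)\<^sup>2" if st: "s \<in> {0..1}" "t \<in> {0..1}" for s t
  proof (cases "\<bar>s - t\<bar> < d")
    case True
    moreover have "0 \<le> 2 * M / d\<^sup>2 * (s - t)\<^sup>2" using M(1) by simp
    ultimately show ?thesis using d(2)[OF st] by linarith
  next
    case False
    then have "d\<^sup>2 \<le> (s - t)\<^sup>2" using d(1) by (metis abs_le_square_iff abs_of_pos not_less)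
    then have "2 * M * 1 \<le> 2 * M * ((s - t)\<^sup>2 / d\<^sup>2)"
      using M(1) d(1) by (intro mult_left_mono) (auto simp: field_simps)
    moreover have "\<bar>a s - a t\<bar> \<le> 2 * M" using M(2)[OF st(1)] M(2)[OF st(2)] by linarith
    ultimately show ?thesis using \<open>e > 0\<close> by simp
  qed
  moreover have "2 * M / d\<^sup>2 \<ge> 0" using M(1) by simp
  ultimately show ?thesis using that by blast
qed

text \<open>The operator commutes asymptotically with multiplication by a continuous function, because the
weights at \<open>t\<close> see only the values of \<open>a\<close> near \<open>t\<close>. The convergence is uniform although
\<open>kantorovich n x\<close> itself need not converge uniformly.\<close>
lemma kantorovich_localizes:
  assumes x: "bounded_measurable x" and a: "continuous_on {0..1} a"
  shows "uniform_limit {0..1} (\<lambda>n t. kantorovich n (\<lambda>s. x s * a s) t - kantorovich n x t * a t)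
           (\<lambda>_. 0) sequentially"
proof (rule uniform_limitI)
  fix e :: real assume "e > 0"
  obtain B where B: "B > 0" "\<And>t. t \<in> {0..1} \<Longrightarrow> \<bar>x t\<bar> \<le> B"
    using bounded_measurable_boundE[OF x] by blast
  \<comment> \<open>Half of \<open>e\<close> pays for the modulus of continuity of \<open>a\<close>, the other half for the variance of the weights, which is \<open>O(1/n)\<close>.\<close>
  have "e / (2 * B) > 0" using \<open>e > 0\<close> B(1) by simp
  then obtain C where C: "C \<ge> 0"
    "\<And>s t. s \<in> {0..1} \<Longrightarrow> t \<in> {0..1} \<Longrightarrow> \<bar>a s - a t\<bar> \<le> e / (2 * B) + C * (s - t)\<^sup>2"
    using continuous_quadratic_modulus[OF a] by blast
  have "(\<lambda>n. B * C * 4 * (1 / real n)) \<longlonglongrightarrow> B * C * 4 * 0"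
    by (intro tendsto_intros lim_1_over_n)
  then have "eventually (\<lambda>n. B * C * 4 * (1 / real n) < e / 2) sequentially"
    using \<open>e > 0\<close> by (intro order_tendstoD) auto
  then show "\<forall>\<^sub>F n in sequentially. \<forall>t\<in>{0..1}.
      dist (kantorovich n (\<lambda>s. x s * a s) t - kantorovich n x t * a t) 0 < e"
    using eventually_gt_at_top[of 0]
  proof eventually_elim
    case (elim n)
    show ?case
    proof
      fix t :: real assume t: "t \<in> {0..1}"
      have m: "bounded_measurable (\<lambda>s. x s * a s)"
        by (intro bounded_measurable_intros x bounded_measurable_continuous a)
      have m': "bounded_measurable (\<lambda>s. x s * (a s - a t))"
        by (intro bounded_measurable_intros x bounded_measurable_continuous a)
      have "kantorovich n (\<lambda>s. x s * a s) t - kantorovich n x t * a t =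
            kantorovich n (\<lambda>s. x s * a s - a t * x s) t"
        by (subst kantorovich_diff) (auto intro: m bounded_measurable_cmult x simp: kantorovich_cmult)
      also have "\<dots> = kantorovich n (\<lambda>s. x s * (a s - a t)) t"
        by (simp add: algebra_simps)
      finally have eq: "kantorovich n (\<lambda>s. x s * a s) t - kantorovich n x t * a t =
        kantorovich n (\<lambda>s. x s * (a s - a t)) t" .
      have "\<bar>kantorovich n (\<lambda>s. x s * (a s - a t)) t\<bar>
          \<le> (\<Sum>k\<le>n. \<bar>Bernstein n k t * cell_mean n (\<lambda>s. x s * (a s - a t)) k\<bar>)"
        unfolding kantorovich_def by (rule sum_abs)
      also have "\<dots> \<le> (\<Sum>k\<le>n. Bernstein n k t *
          (B * (e / (2 * B) + C * (2 / real n + 2 * (real k / real n - t)\<^sup>2))))"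
      proof (rule sum_mono)
        fix k assume "k \<in> {..n}"
        then have k: "k \<le> n" by simp
        have "\<bar>cell_mean n (\<lambda>s. x s * (a s - a t)) k\<bar>
            \<le> B * (e / (2 * B) + C * (2 / real n + 2 * (real k / real n - t)\<^sup>2))"
        proof (rule cell_mean_abs_bound[OF m' k])
          fix s assume s: "s \<in> cell n k"
          then have s01: "s \<in> {0..1}" using cell_subset[OF k] by blast
          have "\<bar>a s - a t\<bar> \<le> e / (2 * B) + C * (s - t)\<^sup>2" by (rule C(2)[OF s01 t])
          also have "\<dots> \<le> e / (2 * B) + C * (2 / real n + 2 * (real k / real n - t)\<^sup>2)"
            using cell_dist_square_le[OF elim(2) k s] C(1) by (simp add: mult_left_mono)
          finally show "\<bar>x s * (a s - a t)\<bar> \<le> B * (e / (2 * B) + C * (2 / real n + 2 * (real k / real n - t)\<^sup>2))"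
            using B s01 by (simp add: abs_mult mult_mono)
        qed
        then show "\<bar>Bernstein n k t * cell_mean n (\<lambda>s. x s * (a s - a t)) k\<bar>
          \<le> Bernstein n k t * (B * (e / (2 * B) + C * (2 / real n + 2 * (real k / real n - t)\<^sup>2)))"
          using t Bernstein_nonneg[of t n k] by (simp add: abs_mult mult_left_mono)
      qed
      also have "\<dots> = (\<Sum>k\<le>n. (e / 2 + 2 * B * C / real n) * Bernstein n k t
          + 2 * B * C * (Bernstein n k t * (real k / real n - t)\<^sup>2))"
        using B(1) by (intro sum.cong) (auto simp: field_simps)
      also have "\<dots> = e / 2 + 2 * B * C / real n + 2 * B * C * (t * (1 - t) / real n)"
        by (simp add: sum.distrib Bernstein_variance[OF elim(2)] flip: sum_distrib_left)
      also have "\<dots> \<le> e / 2 + 2 * B * C / real n + 2 * B * C * (1 / real n)"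
      proof -
        have "t * (1 - t) \<le> 1" using t by (simp add: mult_le_one)
        then have "t * (1 - t) / real n \<le> 1 / real n" by (simp add: divide_right_mono)
        then show ?thesis using B(1) C(1) by (simp add: mult_left_mono del: times_divide_eq_right)
      qed
      also have "\<dots> < e" using elim(1) by simp
      finally show "dist (kantorovich n (\<lambda>s. x s * a s) t - kantorovich n x t * a t) 0 < e"
        unfolding eq by (simp add: dist_real_def)
    qed
  qed
qed

text \<open>The case of \<open>kantorovich_localizes\<close> in which the bounded factor is the constant 1.\<close>
lemma kantorovich_uniform_limit:
  assumes "continuous_on {0..1} g"
  shows "uniform_limit {0..1} (\<lambda>n. kantorovich n g) g sequentially"
  using kantorovich_localizes[OF bounded_measurable_const[of 1] assms]
  by (simp add: uniform_limit_iff kantorovich_const dist_real_def)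

section \<open>Convergence in mean\<close>

text \<open>Measurable functions are almost everywhere limits of continuous ones; truncation at the bound of
\<open>f\<close> keeps the limit and makes dominated convergence applicable.\<close>
lemma bounded_measurable_L1_approx:
  assumes f: "bounded_measurable f" and "e > 0"
  obtains g where "continuous_on {0..1} g" "integral {0..1} (\<lambda>t. \<bar>f t - g t\<bar>) < e"
proof -
  obtain B where B: "B > 0" "\<And>t. t \<in> {0..1} \<Longrightarrow> \<bar>f t\<bar> \<le> B"
    using bounded_measurable_boundE[OF f] by blast
  have "f measurable_on {0..1}"
    using f by (simp add: measurable_on_iff_borel_measurable bounded_measurable_def)
  then obtain N g where N: "negligible N" and g: "\<And>n. continuous_on UNIV (g n)"
    and lim: "\<And>t. t \<notin> N \<Longrightarrow> (\<lambda>n. g n t) \<longlonglongrightarrow> (if t \<in> {0..1} then f t else 0)"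
    unfolding measurable_on_def by metis
  define h where "h n t = max (-B) (min B (g n t))" for n :: nat and t :: real
  have ch: "continuous_on {0..1} (h n)" for n
    unfolding h_def by (intro continuous_intros continuous_on_subset[OF g]) auto
  have hlim: "(\<lambda>n. h n t) \<longlonglongrightarrow> f t" if "t \<in> {0..1}" "t \<notin> N" for t
  proof -
    have "(\<lambda>n. h n t) \<longlonglongrightarrow> max (-B) (min B (f t))"
      unfolding h_def using lim[OF that(2)] that(1) by (intro tendsto_intros) auto
    then show ?thesis using B(2)[OF that(1)] by (simp add: abs_le_iff max_def min_def split: if_splits)
  qed
  \<comment> \<open>Dominated convergence is applied to functions that converge everywhere, so the exceptional null set is zeroed out.\<close>
  define \<phi> where "\<phi> n t = (if t \<in> N then 0 else \<bar>f t - h n t\<bar>)" for n t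
  have int: "(\<lambda>t. \<bar>f t - h n t\<bar>) integrable_on {0..1}" for n
    by (intro bounded_measurable_integrable bounded_measurable_intros f bounded_measurable_continuous ch) auto
  have "(\<lambda>n. integral {0..1} (\<phi> n)) \<longlonglongrightarrow> integral {0..1} (\<lambda>_::real. 0::real)"
  proof (rule dominated_convergence(2)[where h = "\<lambda>_. 2 * B"])
    show "\<phi> n integrable_on {0..1}" for n
      by (rule integrable_spike[OF int[of n] N]) (auto simp: \<phi>_def)
    show "norm (\<phi> n t) \<le> 2 * B" if "t \<in> {0..1}" for n t
      using B(1) B(2)[OF that] by (auto simp: \<phi>_def h_def)
    show "(\<lambda>n. \<phi> n t) \<longlonglongrightarrow> 0" if "t \<in> {0..1}" for t
    proof (cases "t \<in> N")
      case False
      have "(\<lambda>n. \<bar>f t - h n t\<bar>) \<longlonglongrightarrow> \<bar>f t - f t\<bar>"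
        by (intro tendsto_intros hlim that False)
      with False show ?thesis by (simp add: \<phi>_def)
    qed (simp add: \<phi>_def)
  qed auto
  then have "eventually (\<lambda>n. integral {0..1} (\<phi> n) < e) sequentially"
    using \<open>e > 0\<close> by (intro order_tendstoD) auto
  then obtain n where "integral {0..1} (\<phi> n) < e"
    using eventually_happens by force
  moreover have "integral {0..1} (\<phi> n) = integral {0..1} (\<lambda>t. \<bar>f t - h n t\<bar>)"
    by (rule integral_spike[OF N]) (auto simp: \<phi>_def)
  ultimately show ?thesis using that[OF ch[of n]] by simp
qed

text \<open>A Beta integral. Its value does not depend on \<open>k\<close> and equals the length of a cell, which is what
makes the operator an \<open>L\<^sup>1\<close> contraction.\<close>
lemma has_integral_Bernstein:
  assumes "k \<le> n"
  shows "(Bernstein n k has_integral 1 / (real n + 1)) {0..1}"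
proof -
  let ?a = "real k + 1" and ?b = "real (n - k) + 1"
  have "((\<lambda>t. t powr (?a - 1) * (1 - t) powr (?b - 1)) has_integral Beta ?a ?b) {0..1}"
    by (rule has_integral_Beta_real) auto
  then have "((\<lambda>t. t ^ k * (1 - t) ^ (n - k)) has_integral Beta ?a ?b) {0..1}"
    \<comment> \<open>At the endpoints \<open>powr\<close> and \<open>^\<close> disagree on the zeroth power of 0.\<close>
    by (rule has_integral_spike_finite[of "{0, 1}", rotated 2]) (auto simp: powr_realpow)
  then have "((\<lambda>t. real (n choose k) * (t ^ k * (1 - t) ^ (n - k))) has_integral
      real (n choose k) * Beta ?a ?b) {0..1}"
    by (rule has_integral_mult_right)
  moreover have "real (n choose k) * Beta ?a ?b = 1 / (real n + 1)"
  proof -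
    have "?a + ?b = 1 + real (Suc n)" using assms by (simp add: of_nat_diff)
    then have "Beta ?a ?b = fact k * fact (n - k) / fact (Suc n)"
      unfolding Beta_def by (simp only: Gamma_fact add.commute[of _ 1])
    also have "fact (Suc n) = (real n + 1) * fact n" by simp
    finally show ?thesis by (simp add: binomial_fact[OF assms, where 'a = real])
  qed
  ultimately show ?thesis by (simp add: Bernstein_def[abs_def] mult.assoc)
qed

lemma sum_integral_cells:
  assumes "bounded_measurable f"
  shows "(\<Sum>k\<le>n. integral (cell n k) f) = integral {0..1} f"
proof -
  have "m \<le> Suc n \<Longrightarrow> (\<Sum>k<m. integral (cell n k) f) = integral {0..real m / (real n + 1)} f" for m
  proof (induction m)
    case (Suc m)
    have "integral {0..real m / (real n + 1)} f
        + integral {real m / (real n + 1)..real (Suc m) / (real n + 1)} f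
        = integral {0..real (Suc m) / (real n + 1)} f"
    proof (rule Henstock_Kurzweil_Integration.integral_combine)
      have "real (Suc m) / (real n + 1) \<le> 1" using Suc.prems by simp
      then show "f integrable_on {0..real (Suc m) / (real n + 1)}"
        by (intro bounded_measurable_integrable assms) auto
    qed (auto simp: divide_right_mono)
    with Suc show ?case by (simp add: cell_def add.commute)
  qed simp
  from this[of "Suc n"] show ?thesis by (simp add: lessThan_Suc_atMost add.commute)
qed

text \<open>Each Bernstein polynomial has integral equal to the length of its cell, so integrating the weighted
sum of absolute means gives back at most the sum of the integrals of \<open>\<bar>f\<bar>\<close> over the cells.\<close>
lemma kantorovich_L1_contraction:
  assumes f: "bounded_measurable f"
  shows "integral {0..1} (\<lambda>t. \<bar>kantorovich n f t\<bar>) \<le> integral {0..1} (\<lambda>t. \<bar>f t\<bar>)"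
proof -
  have HI: "((\<lambda>t. \<Sum>k\<le>n. Bernstein n k t * \<bar>cell_mean n f k\<bar>) has_integral
      (\<Sum>k\<le>n. 1 / (real n + 1) * \<bar>cell_mean n f k\<bar>)) {0..1}"
    by (intro has_integral_sum has_integral_mult_left has_integral_Bernstein) auto
  have "integral {0..1} (\<lambda>t. \<bar>kantorovich n f t\<bar>) \<le> (\<Sum>k\<le>n. 1 / (real n + 1) * \<bar>cell_mean n f k\<bar>)"
  proof (rule has_integral_le[OF integrable_integral HI])
    show "(\<lambda>t. \<bar>kantorovich n f t\<bar>) integrable_on {0..1}"
      by (intro bounded_measurable_integrable bounded_measurable_intros bounded_measurable_kantorovich) auto
    show "\<bar>kantorovich n f t\<bar> \<le> (\<Sum>k\<le>n. Bernstein n k t * \<bar>cell_mean n f k\<bar>)" if "t \<in> {0..1}" for t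
      unfolding kantorovich_def using that Bernstein_nonneg[of t n]
      by (intro order_trans[OF sum_abs] sum_mono) (auto simp: abs_mult)
  qed
  also have "\<dots> \<le> (\<Sum>k\<le>n. integral (cell n k) (\<lambda>t. \<bar>f t\<bar>))"
  proof (rule sum_mono)
    fix k assume "k \<in> {..n}"
    then have "norm (integral (cell n k) f) \<le> integral (cell n k) (\<lambda>t. \<bar>f t\<bar>)"
      by (intro integral_norm_bound_integral cell_integrable f bounded_measurable_intros) auto
    then show "1 / (real n + 1) * \<bar>cell_mean n f k\<bar> \<le> integral (cell n k) (\<lambda>t. \<bar>f t\<bar>)"
      by (simp add: cell_mean_def abs_mult)
  qed
  also have "\<dots> = integral {0..1} (\<lambda>t. \<bar>f t\<bar>)"
    by (intro sum_integral_cells bounded_measurable_intros f)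
  finally show ?thesis .
qed

text \<open>The usual density argument: the operators are uniformly bounded on \<open>L\<^sup>1\<close> and converge uniformly at
each continuous function.\<close>
lemma kantorovich_L1_tendsto:
  assumes f: "bounded_measurable f"
  shows "(\<lambda>n. integral {0..1} (\<lambda>t. \<bar>kantorovich n f t - f t\<bar>)) \<longlonglongrightarrow> 0"
proof (rule LIMSEQ_I)
  fix e :: real assume "e > 0"
  then obtain g where g: "continuous_on {0..1} g" "integral {0..1} (\<lambda>t. \<bar>f t - g t\<bar>) < e / 3"
    using bounded_measurable_L1_approx[OF f, of "e / 3"] by auto
  note gm = bounded_measurable_continuous[OF g(1)]
  have "eventually (\<lambda>n. \<forall>t\<in>{0..1}. \<bar>kantorovich n g t - g t\<bar> < e / 3) sequentially"
    using uniform_limitD[OF kantorovich_uniform_limit[OF g(1)], of "e / 3"] \<open>e > 0\<close>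
    by (simp add: dist_real_def)
  then obtain n0 where n0: "\<And>n t. n \<ge> n0 \<Longrightarrow> t \<in> {0..1} \<Longrightarrow> \<bar>kantorovich n g t - g t\<bar> < e / 3"
    unfolding eventually_sequentially by blast
  have "norm (integral {0..1} (\<lambda>t. \<bar>kantorovich n f t - f t\<bar>) - 0) < e" if "n \<ge> n0" for n
  proof -
    let ?u = "\<lambda>t. \<bar>kantorovich n (\<lambda>t. f t - g t) t\<bar>"
    let ?w = "\<lambda>t. \<bar>f t - g t\<bar>"
    have i: "?u integrable_on {0..1}" "?w integrable_on {0..1}"
      "(\<lambda>t. \<bar>kantorovich n f t - f t\<bar>) integrable_on {0..1}"
      by (intro bounded_measurable_integrable bounded_measurable_intros
            bounded_measurable_kantorovich f gm order_refl)+
    have "integral {0..1} (\<lambda>t. \<bar>kantorovich n f t - f t\<bar>)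
        \<le> integral {0..1} (\<lambda>t. ?u t + e / 3 + ?w t)"
    proof (rule integral_le)
      show "\<bar>kantorovich n f t - f t\<bar> \<le> ?u t + e / 3 + ?w t" if "t \<in> {0..1}" for t
        using n0[OF \<open>n \<ge> n0\<close> that] kantorovich_diff[OF f gm, of n t] by linarith
    qed (intro integrable_add i integrable_const_ivl)+
    also have "\<dots> = integral {0..1} ?u + e / 3 + integral {0..1} ?w"
      by (simp add: Henstock_Kurzweil_Integration.integral_add integrable_add i integrable_const_ivl)
    also have "\<dots> < e"
      using kantorovich_L1_contraction[OF bounded_measurable_diff[OF f gm], of n] g(2) by simp
    finally have "integral {0..1} (\<lambda>t. \<bar>kantorovich n f t - f t\<bar>) < e" .
    moreover have "0 \<le> integral {0..1} (\<lambda>t. \<bar>kantorovich n f t - f t\<bar>)"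
      by (rule Henstock_Kurzweil_Integration.integral_nonneg[OF i(3)]) simp
    ultimately show ?thesis by simp
  qed
  then show "\<exists>no. \<forall>n\<ge>no. norm (integral {0..1} (\<lambda>t. \<bar>kantorovich n f t - f t\<bar>) - 0) < e"
    by blast
qed

section \<open>The integral term\<close>

lemma uniform_limit_finite_sum:
  fixes f :: "'i \<Rightarrow> 'b \<Rightarrow> 'a \<Rightarrow> 'c::real_normed_vector"
  assumes "\<And>i. i \<in> I \<Longrightarrow> uniform_limit S (f i) (l i) G"
  shows "uniform_limit S (\<lambda>n t. \<Sum>i\<in>I. f i n t) (\<lambda>t. \<Sum>i\<in>I. l i t) G"
  using assms
  by (induction I rule: infinite_finite_induct) (auto intro: uniform_limit_add uniform_limit_const)

text \<open>Turns \<open>L\<^sup>1\<close> convergence into convergence of weighted integrals that is uniform in the upper limit;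
this serves both the integral term of \<open>F\<close> and the objective.\<close>
lemma abs_weighted_integral_le:
  assumes f: "bounded_measurable f" and w: "continuous_on {0..1} w"
    and C: "\<And>s. s \<in> {0..1} \<Longrightarrow> \<bar>w s\<bar> \<le> C" and t: "t \<in> {0..1}"
  shows "\<bar>integral {0..t} (\<lambda>s. f s * w s)\<bar> \<le> C * integral {0..1} (\<lambda>s. \<bar>f s\<bar>)"
proof -
  have sub: "{0..t} \<subseteq> {0..1}" using t by auto
  have m: "bounded_measurable (\<lambda>s. C * \<bar>f s\<bar>)" "bounded_measurable (\<lambda>s. f s * w s)"
    by (intro bounded_measurable_intros f bounded_measurable_continuous w)+
  have "C \<ge> 0" using C[of 0] by simp
  have "norm (integral {0..t} (\<lambda>s. f s * w s)) \<le> integral {0..t} (\<lambda>s. C * \<bar>f s\<bar>)"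
  proof (rule integral_norm_bound_integral)
    show "norm (f s * w s) \<le> C * \<bar>f s\<bar>" if "s \<in> {0..t}" for s
      using C[of s] that sub by (auto simp: abs_mult mult.commute[of C] intro!: mult_left_mono)
  qed (use m sub in \<open>auto intro!: bounded_measurable_integrable\<close>)
  also have "\<dots> \<le> integral {0..1} (\<lambda>s. C * \<bar>f s\<bar>)"
    by (rule integral_subset_le)
       (use m sub \<open>C \<ge> 0\<close> in \<open>auto intro!: bounded_measurable_integrable\<close>)
  finally show ?thesis by simp
qed

text \<open>The kernel \<open>P\<close> is a polynomial in \<open>s\<close> over the polynomials in \<open>t\<close>, so it is evaluated first at
the constant polynomial \<open>[:s:]\<close> and then at \<open>t\<close>.\<close>
definition volterra :: "real poly poly \<Rightarrow> (real \<Rightarrow> real) \<Rightarrow> real \<Rightarrow> real" where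
  "volterra P f t = integral {0..t} (\<lambda>s. f s * poly (poly P [:s:]) t)"

lemma poly_poly_expand:
  "poly (poly P [:s:]) t = (\<Sum>j\<le>degree P. poly (coeff P j) t * s ^ j)"
  for s t :: "'a::comm_ring_1"
  unfolding poly_altdef[of P] by (simp add: poly_sum poly_power)

lemma continuous_on_poly_poly: "continuous_on S (\<lambda>s. poly (poly P [:s:]) (t::real))"
  unfolding poly_poly_expand by (intro continuous_intros)

text \<open>A polynomial kernel separates the variables, so the dependence on \<open>t\<close> inside the integrand can be
moved outside. Continuity in \<open>t\<close> then follows from that of indefinite integrals.\<close>
lemma volterra_expand:
  assumes "bounded_measurable f" "t \<in> {0..1}"
  shows "volterra P f t = (\<Sum>j\<le>degree P. poly (coeff P j) t * integral {0..t} (\<lambda>s. f s * s ^ j))"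
proof -
  have i: "(\<lambda>s. f s * s ^ j) integrable_on {0..t}" for j
    using assms(2)
    by (intro bounded_measurable_integrable bounded_measurable_mult assms(1)
          bounded_measurable_continuous continuous_intros) auto
  have "volterra P f t = integral {0..t} (\<lambda>s. \<Sum>j\<le>degree P. poly (coeff P j) t * (f s * s ^ j))"
    by (simp add: volterra_def poly_poly_expand sum_distrib_left mult_ac)
  also have "\<dots> = (\<Sum>j\<le>degree P. integral {0..t} (\<lambda>s. poly (coeff P j) t * (f s * s ^ j)))"
    by (rule Henstock_Kurzweil_Integration.integral_sum)
       (auto intro!: integrable_on_cmult_left[where 'b = real, simplified] i)
  finally show ?thesis by simp
qed

lemma continuous_on_volterra:
  assumes "bounded_measurable f"
  shows "continuous_on {0..1} (volterra P f)"
proof -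
  have "continuous_on {0..1} (\<lambda>t. integral {0..t} (\<lambda>s. f s * s ^ j))" for j
    by (intro indefinite_integral_continuous_1 bounded_measurable_integrable bounded_measurable_mult
          assms bounded_measurable_continuous continuous_intros order_refl)
  then have "continuous_on {0..1}
      (\<lambda>t. \<Sum>j\<le>degree P. poly (coeff P j) t * integral {0..t} (\<lambda>s. f s * s ^ j))"
    by (intro continuous_intros)
  then show ?thesis
    using volterra_expand[OF assms] by (subst continuous_on_cong[OF refl]) auto
qed

lemma volterra_add:
  assumes "bounded_measurable f" "bounded_measurable g" "t \<in> {0..1}"
  shows "volterra P (\<lambda>s. f s + g s) t = volterra P f t + volterra P g t"
proof -
  have "(\<lambda>s. h s * poly (poly P [:s:]) t) integrable_on {0..t}" if "bounded_measurable h" for h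
    using assms(3)
    by (intro bounded_measurable_integrable bounded_measurable_mult that
          bounded_measurable_continuous continuous_on_poly_poly) auto
  then show ?thesis using assms(1,2)
    by (simp add: volterra_def distrib_right Henstock_Kurzweil_Integration.integral_add)
qed

lemma volterra_cmult: "volterra P (\<lambda>s. c * f s) t = c * volterra P f t"
  by (simp add: volterra_def mult.assoc)

text \<open>The kernel is bounded on the unit square, so \<open>L\<^sup>1\<close> convergence of the argument gives uniform
convergence of the integral term.\<close>
lemma volterra_kantorovich_uniform_limit:
  assumes f: "bounded_measurable f"
  shows "uniform_limit {0..1} (\<lambda>n. volterra P (kantorovich n f)) (volterra P f) sequentially"
proof -
  have "continuous_on ({0..1} \<times> {0..1}) (\<lambda>z. poly (poly P [:snd z:]) (fst z))"
    unfolding poly_poly_expand by (intro continuous_intros)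
  then have "bounded ((\<lambda>z. poly (poly P [:snd z:]) (fst z)) ` ({0..1} \<times> {0..1::real}))"
    by (intro compact_imp_bounded compact_continuous_image compact_Times) auto
  then obtain C where C: "\<And>t s. t \<in> {0..1} \<Longrightarrow> s \<in> {0..1} \<Longrightarrow> \<bar>poly (poly P [:s:]) t\<bar> \<le> C"
    unfolding bounded_iff by fastforce
  have bound: "\<bar>volterra P (kantorovich n f) t - volterra P f t\<bar>
      \<le> C * integral {0..1} (\<lambda>s. \<bar>kantorovich n f s - f s\<bar>)" if t: "t \<in> {0..1}" for n t
  proof -
    have "volterra P (kantorovich n f) t - volterra P f t = volterra P (\<lambda>s. kantorovich n f s - f s) t"
      using volterra_add[OF bounded_measurable_kantorovich bounded_measurable_cmult[OF f, of "-1"] t, of P n f]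
        volterra_cmult[of P "-1" f t]
      by simp
    then show ?thesis
      unfolding volterra_def using t C
      by (simp only: abs_weighted_integral_le bounded_measurable_diff bounded_measurable_kantorovich f
          continuous_on_poly_poly)
  qed
  have "(\<lambda>n. C * integral {0..1} (\<lambda>s. \<bar>kantorovich n f s - f s\<bar>)) \<longlonglongrightarrow> C * 0"
    by (intro tendsto_intros kantorovich_L1_tendsto f)
  then have "eventually (\<lambda>n. C * integral {0..1} (\<lambda>s. \<bar>kantorovich n f s - f s\<bar>) < e) sequentially"
    if "e > 0" for e
    using that by (intro order_tendstoD) auto
  moreover have "\<forall>t\<in>{0..1}. dist (volterra P (kantorovich n f) t) (volterra P f t) < e"
    if "C * integral {0..1} (\<lambda>s. \<bar>kantorovich n f s - f s\<bar>) < e" for n e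
    unfolding dist_real_def using bound[of _ n] that by (meson le_less_trans)
  ultimately show ?thesis
    by (intro uniform_limitI) (rule eventually_mono)
qed

section \<open>Smoothing the control\<close>

lemma Linf_component:
  assumes "x \<in> Linf"
  shows "bounded_measurable (\<lambda>t. x t $ i)"
proof -
  have "(\<lambda>t. x t $ i) \<in> borel_measurable (lebesgue_on {0..1})"
    by (rule borel_measurable_continuous_on[of "\<lambda>v. v $ i", simplified])
       (use assms in \<open>auto simp: Linf_def intro!: continuous_intros\<close>)
  then show ?thesis using assms by (auto simp: Linf_def bounded_measurable_def)
qed

lemma LinfI:
  assumes "\<And>i. bounded_measurable (\<lambda>t. x t $ i)"
  shows "x \<in> Linf"
proof -
  have "x \<in> borel_measurable (lebesgue_on {0..1})"
  proof (subst borel_measurable_euclidean_space, intro ballI)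
    fix b :: "real^'a" assume "b \<in> Basis"
    then obtain i where "b = axis i 1" by (auto simp: Basis_vec_def)
    then show "(\<lambda>t. x t \<bullet> b) \<in> borel_measurable (lebesgue_on {0..1})"
      using assms[of i] by (simp add: inner_axis bounded_measurable_def)
  qed
  moreover have "\<forall>i. \<exists>B. B > 0 \<and> (\<forall>t\<in>{0..1}. \<bar>x t $ i\<bar> \<le> B)"
    using assms bounded_measurable_boundE by metis
  then obtain B where B: "\<And>i. B i > 0" "\<And>i t. t \<in> {0..1} \<Longrightarrow> \<bar>x t $ i\<bar> \<le> B i"
    by metis
  have "\<bar>x t $ i\<bar> \<le> (\<Sum>i\<in>UNIV. B i)" if "t \<in> {0..1}" for t i
    using B(2)[OF that, of i] member_le_sum[of i UNIV B] B(1) by (fastforce simp: less_imp_le)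
  then have "\<exists>C. \<forall>t\<in>{0..1}. \<forall>i. \<bar>x t $ i\<bar> \<le> C" by blast
  ultimately show ?thesis by (simp add: Linf_def)
qed

text \<open>The entry of \<open>F x t\<close> in row \<open>p\<close> and column \<open>q\<close>, with the matrix-valued integral replaced by scalar
ones; this presupposes integrability, so \<open>F_component\<close> identifies the two for \<open>x \<in> Linf\<close> and
\<open>t \<in> {0..1}\<close>.\<close>
definition F_entry :: "real poly^'m^'m \<Rightarrow> ('n::finite \<Rightarrow> real poly^'m^'m) \<Rightarrow> ('n \<Rightarrow> real poly poly^'m^'m)
    \<Rightarrow> (real \<Rightarrow> real^'n) \<Rightarrow> 'm \<Rightarrow> 'm \<Rightarrow> real \<Rightarrow> real" where
  "F_entry A0 A D x p q t = poly (A0 $ p $ q) t + (\<Sum>i\<in>UNIV. x t $ i * poly (A i $ p $ q) t)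
     + (\<Sum>i\<in>UNIV. volterra (D i $ p $ q) (\<lambda>s. x s $ i) t)"

lemma F_component:
  fixes A0 :: "real poly^'m^'m"
  assumes x: "x \<in> Linf" and t: "t \<in> {0..1}"
  shows "F A0 A D x t $ p $ q = F_entry A0 A D x p q t"
proof -
  have sub: "{0..t} \<subseteq> {0..1}" using t by auto
  have "(LINT s:{0..t}|lebesgue. x s $ i *\<^sub>R eval_mat2 (D i) t s) $ p $ q
      = volterra (D i $ p $ q) (\<lambda>s. x s $ i) t" for i
  proof -
    let ?M = "\<lambda>s. x s $ i *\<^sub>R eval_mat2 (D i) t s"
    have "(\<lambda>s. eval_mat2 (D i) t s) absolutely_integrable_on {0..1}"
      unfolding eval_mat2_def
      by (intro absolutely_integrable_continuous_real continuous_on_vec_lambda continuous_on_poly_poly)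
    moreover have "bounded ((\<lambda>s. x s $ i) ` {0..1})"
      using Linf_component[OF x, of i] by (auto simp: bounded_measurable_def bounded_iff)
    ultimately have "?M absolutely_integrable_on {0..1}"
      using Linf_component[OF x, of i]
      by (intro absolutely_integrable_bounded_measurable_product[where h = scaleR])
         (auto simp: bounded_measurable_def bilinear_conv_bounded_bilinear bounded_bilinear_scaleR)
    then have ai: "?M absolutely_integrable_on {0..t}"
      by (rule set_integrable_subset) (use sub in auto)
    note M = set_lebesgue_integral_eq_integral[OF ai]
    have "bounded_linear (\<lambda>N :: real^'m^'m. N $ p $ q)"
      using bounded_linear_compose[OF bounded_linear_vec_nth bounded_linear_vec_nth] .
    then have "integral {0..t} ?M $ p $ q = integral {0..t} (\<lambda>s. ?M s $ p $ q)"
      using integral_linear[OF M(1)] by (fastforce simp: o_def)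
    then show ?thesis
      unfolding M(2) by (simp add: eval_mat2_def volterra_def)
  qed
  then show ?thesis by (simp add: F_def F_entry_def eval_mat_def)
qed

lemma bounded_measurable_F_entry:
  assumes "x \<in> Linf"
  shows "bounded_measurable (F_entry A0 A D x p q)"
  unfolding F_entry_def[abs_def]
  by (intro bounded_measurable_intros Linf_component assms bounded_measurable_continuous
        continuous_on_volterra continuous_intros)

definition kantorovich_vec :: "nat \<Rightarrow> (real \<Rightarrow> real^'n) \<Rightarrow> real \<Rightarrow> real^'n" where
  "kantorovich_vec n x t = (\<chi> i. kantorovich n (\<lambda>s. x s $ i) t)"

lemma kantorovich_vec_Linf: "kantorovich_vec n x \<in> Linf"
  by (rule LinfI) (simp add: kantorovich_vec_def bounded_measurable_kantorovich)

text \<open>The key estimate: smoothing the control and smoothing the constraint function are asymptotically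
the same. The polynomial part of \<open>F\<close> and its integral term are continuous in \<open>t\<close>, hence hardly
changed by smoothing; the terms \<open>x\<^sub>i A\<^sub>i\<close> are covered by \<open>kantorovich_localizes\<close>; and the
integral term of the smoothed control is close to that of \<open>x\<close> by convergence in mean.\<close>
lemma F_entry_kantorovich_vec:
  fixes x :: "real \<Rightarrow> real^'n"
  assumes x: "x \<in> Linf"
  shows "uniform_limit {0..1}
    (\<lambda>n t. F_entry A0 A D (kantorovich_vec n x) p q t - kantorovich n (F_entry A0 A D x p q) t)
    (\<lambda>_. 0) sequentially"
proof -
  let ?x = "\<lambda>i s. x s $ i" and ?a = "\<lambda>i. poly (A i $ p $ q)" and ?d = "\<lambda>i. D i $ p $ q"
  note xm = Linf_component[OF x]
  have a0: "continuous_on {0..1} (poly (A0 $ p $ q))" and a: "\<And>i. continuous_on {0..1} (?a i)"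
    by (intro continuous_intros)+
  note v = continuous_on_volterra[OF xm]
  have split: "F_entry A0 A D (kantorovich_vec n x) p q t - kantorovich n (F_entry A0 A D x p q) t =
      (poly (A0 $ p $ q) t - kantorovich n (poly (A0 $ p $ q)) t)
      - (\<Sum>i\<in>UNIV. kantorovich n (\<lambda>s. ?x i s * ?a i s) t - kantorovich n (?x i) t * ?a i t)
      + (\<Sum>i\<in>UNIV. volterra (?d i) (kantorovich n (?x i)) t - kantorovich n (volterra (?d i) (?x i)) t)"
    for n t
  proof -
    have "kantorovich n (F_entry A0 A D x p q) t = kantorovich n (poly (A0 $ p $ q)) t
      + (\<Sum>i\<in>UNIV. kantorovich n (\<lambda>s. ?x i s * ?a i s) t)
      + (\<Sum>i\<in>UNIV. kantorovich n (volterra (?d i) (?x i)) t)"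
      unfolding F_entry_def[abs_def]
      by (simp add: kantorovich_add kantorovich_sum bounded_measurable_intros xm
          bounded_measurable_continuous[OF a0] bounded_measurable_continuous[OF a]
          bounded_measurable_continuous[OF v])
    then show ?thesis
      by (simp add: F_entry_def kantorovich_vec_def sum_subtractf)
  qed
  have "uniform_limit {0..1} (\<lambda>n t.
      (poly (A0 $ p $ q) t - kantorovich n (poly (A0 $ p $ q)) t)
      - (\<Sum>i\<in>UNIV. kantorovich n (\<lambda>s. ?x i s * ?a i s) t - kantorovich n (?x i) t * ?a i t)
      + (\<Sum>i\<in>UNIV. volterra (?d i) (kantorovich n (?x i)) t - kantorovich n (volterra (?d i) (?x i)) t))
    (\<lambda>t. (poly (A0 $ p $ q) t - poly (A0 $ p $ q) t) - (\<Sum>i\<in>(UNIV::'n set). 0)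
      + (\<Sum>i\<in>UNIV. volterra (?d i) (?x i) t - volterra (?d i) (?x i) t)) sequentially"
    by (intro uniform_limit_add uniform_limit_minus uniform_limit_finite_sum uniform_limit_const
          kantorovich_uniform_limit a0 kantorovich_localizes xm a
          volterra_kantorovich_uniform_limit v)
  then show ?thesis by (simp add: split)
qed

section \<open>Preservation of the matrix inequality\<close>

lemma quadratic_form_entries:
  fixes M :: "real^'m^'m"
  shows "v \<bullet> (M *v v) = (\<Sum>p\<in>UNIV. \<Sum>q\<in>UNIV. v $ p * v $ q * M $ p $ q)"
  by (simp add: inner_vec_def matrix_vector_mult_def sum_distrib_left mult_ac)

lemma loewner_ge_scaled_mat_1_iff:
  "M \<succeq> c *\<^sub>R mat 1 \<longleftrightarrow> transpose M = M \<and> (\<forall>v. c * (v \<bullet> v) \<le> v \<bullet> (M *v v))"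
proof -
  have "transpose (M - c *\<^sub>R mat 1) = M - c *\<^sub>R mat 1 \<longleftrightarrow> transpose M = M"
    by (simp add: vec_eq_iff transpose_def mat_def) metis
  moreover have "v \<bullet> ((M - c *\<^sub>R mat 1) *v v) = v \<bullet> (M *v v) - c * (v \<bullet> v)" for v
    by (simp add: matrix_vector_mult_diff_rdistrib inner_diff_right flip: scaleR_matrix_vector_assoc)
  ultimately show ?thesis by (simp add: loewner_ge_def psd_def)
qed

text \<open>Makes the criterion above cover the constraint of the program, as the case of a zero margin.\<close>
lemma loewner_ge_0_iff: "M \<succeq> 0 \<longleftrightarrow> M \<succeq> 0 *\<^sub>R mat 1"
  by simp

lemma loewner_ge_convex_combination:
  assumes "M \<succeq> 0" "N \<succeq> c *\<^sub>R mat 1" "0 \<le> l" "l \<le> 1"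
  shows "(1 - l) *\<^sub>R M + l *\<^sub>R N \<succeq> (l * c) *\<^sub>R mat 1"
proof -
  have M: "transpose M = M" "\<And>v. 0 \<le> v \<bullet> (M *v v)"
    and N: "transpose N = N" "\<And>v. c * (v \<bullet> v) \<le> v \<bullet> (N *v v)"
    using assms(1,2) unfolding loewner_ge_0_iff loewner_ge_scaled_mat_1_iff by auto
  have "transpose ((1 - l) *\<^sub>R M + l *\<^sub>R N) = (1 - l) *\<^sub>R M + l *\<^sub>R N"
    using M(1) N(1) by (simp add: vec_eq_iff transpose_def)
  moreover have "l * c * (v \<bullet> v) \<le> v \<bullet> (((1 - l) *\<^sub>R M + l *\<^sub>R N) *v v)" for v
  proof -
    have "v \<bullet> (((1 - l) *\<^sub>R M + l *\<^sub>R N) *v v) = (1 - l) * (v \<bullet> (M *v v)) + l * (v \<bullet> (N *v v))"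
      by (simp add: matrix_vector_mult_add_rdistrib inner_add_right flip: scaleR_matrix_vector_assoc)
    moreover have "0 \<le> (1 - l) * (v \<bullet> (M *v v))" "l * (c * (v \<bullet> v)) \<le> l * (v \<bullet> (N *v v))"
      using M(2) N(2) assms(3,4) by (auto intro: mult_left_mono)
    ultimately show ?thesis by simp
  qed
  ultimately show ?thesis unfolding loewner_ge_scaled_mat_1_iff by blast
qed

lemma symmetric_entry: "transpose M = M \<Longrightarrow> M $ p $ q = M $ q $ p"
  by (metis transpose_def vec_lambda_beta)

lemma transpose_F:
  assumes "transpose A0 = A0" "\<And>i. transpose (A i) = A i" "\<And>i. transpose (D i) = D i"
    and "x \<in> Linf" "t \<in> {0..1}"
  shows "transpose (F A0 A D x t) = F A0 A D x t"
proof -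
  note sym = symmetric_entry[OF assms(1)] symmetric_entry[OF assms(2)] symmetric_entry[OF assms(3)]
  have "F_entry A0 A D x q p t = F_entry A0 A D x p q t" for p q
    by (simp add: F_entry_def sym[where p = q and q = p])
  then show ?thesis
    by (simp add: vec_eq_iff transpose_def F_component[OF assms(4,5)])
qed

text \<open>The smoothed constraint function \<open>K\<^sub>n (F x)\<close> is bounded below by \<open>\<epsilon> I\<close> at every \<open>t\<close>, by positivity of
the operator applied to each quadratic form. By \<open>F_entry_kantorovich_vec\<close> the matrix
\<open>F (K\<^sub>n x)\<close> is uniformly close to it, and the margin absorbs the difference.\<close>
lemma polynomial_strict_approximation:
  fixes A0 :: "real poly^'m^'m"
  assumes sym: "transpose A0 = A0" "\<And>i. transpose (A i) = A i" "\<And>i. transpose (D i) = D i"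
    and x: "x \<in> Linf" and "\<epsilon> > 0"
    and AE: "AE t in lebesgue_on {0..1}. F A0 A D x t \<succeq> \<epsilon> *\<^sub>R mat 1"
  shows "\<forall>\<^sub>F n in sequentially. \<forall>t\<in>{0..1}. F A0 A D (kantorovich_vec n x) t \<succeq> 0"
proof -
  \<comment> \<open>If all entries of a matrix change by at most \<open>\<eta>\<close>, its quadratic form at \<open>v\<close> changes by at most \<open>(CARD('m))\<^sup>2 * \<eta> * (v \<bullet> v)\<close>.\<close>
  define \<eta> where "\<eta> = \<epsilon> / (real CARD('m))\<^sup>2"
  have \<eta>: "\<eta> > 0" using \<open>\<epsilon> > 0\<close> by (simp add: \<eta>_def)
  let ?K = "\<lambda>n. kantorovich_vec n x"
  let ?\<Phi> = "F_entry A0 A D x"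
  have "\<forall>\<^sub>F n in sequentially. \<forall>p q. \<forall>t\<in>{0..1}.
      \<bar>F_entry A0 A D (?K n) p q t - kantorovich n (?\<Phi> p q) t\<bar> < \<eta>"
    using uniform_limitD[OF F_entry_kantorovich_vec[OF x] \<eta>]
    by (intro eventually_all_finite) (simp add: dist_real_def)
  then show ?thesis
  proof (rule eventually_mono, intro ballI)
    fix n and t :: real
    assume close: "\<forall>p q. \<forall>t\<in>{0..1}. \<bar>F_entry A0 A D (?K n) p q t - kantorovich n (?\<Phi> p q) t\<bar> < \<eta>"
      and t: "t \<in> {0..1}"
    have "0 \<le> v \<bullet> (F A0 A D (?K n) t *v v)" for v
    proof -
      let ?Q = "\<lambda>s. \<Sum>p\<in>UNIV. \<Sum>q\<in>UNIV. v $ p * v $ q * ?\<Phi> p q s"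
      note m = bounded_measurable_F_entry[OF x]
      have "AE s in lebesgue_on {0..1}. \<epsilon> * (v \<bullet> v) \<le> ?Q s"
        using AE
      proof (rule AE_mp, intro AE_I2 impI)
        fix s assume "s \<in> space (lebesgue_on {0..1})" and ge: "F A0 A D x s \<succeq> \<epsilon> *\<^sub>R mat 1"
        then have "s \<in> {0..1}" by simp
        then show "\<epsilon> * (v \<bullet> v) \<le> ?Q s"
          using ge unfolding loewner_ge_scaled_mat_1_iff
          by (simp add: quadratic_form_entries F_component[OF x])
      qed
      then have "\<epsilon> * (v \<bullet> v) \<le> kantorovich n ?Q t"
        by (intro kantorovich_lower_bound_AE t bounded_measurable_sum bounded_measurable_cmult m)
      also have "\<dots> = (\<Sum>p\<in>UNIV. \<Sum>q\<in>UNIV. v $ p * v $ q * kantorovich n (?\<Phi> p q) t)"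
        by (simp add: kantorovich_sum kantorovich_cmult bounded_measurable_sum bounded_measurable_cmult m)
      also have "\<dots> \<le> (\<Sum>p\<in>UNIV. \<Sum>q\<in>UNIV. v $ p * v $ q * F_entry A0 A D (?K n) p q t + \<eta> * (v \<bullet> v))"
      proof (intro sum_mono)
        fix p q :: 'm
        have "\<bar>v $ p\<bar> * \<bar>v $ q\<bar> \<le> norm v * norm v"
          by (intro mult_mono component_le_norm_cart) auto
        then have vv: "\<bar>v $ p * v $ q\<bar> \<le> v \<bullet> v"
          by (simp add: abs_mult dot_square_norm power2_eq_square)
        have "v $ p * v $ q * kantorovich n (?\<Phi> p q) t - v $ p * v $ q * F_entry A0 A D (?K n) p q t
          \<le> \<bar>v $ p * v $ q\<bar> * \<bar>F_entry A0 A D (?K n) p q t - kantorovich n (?\<Phi> p q) t\<bar>"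
          by (simp add: right_diff_distrib flip: abs_mult)
        also have "\<dots> \<le> (v \<bullet> v) * \<eta>"
          using vv close t by (intro mult_mono) (auto simp: less_imp_le)
        finally show "v $ p * v $ q * kantorovich n (?\<Phi> p q) t
            \<le> v $ p * v $ q * F_entry A0 A D (?K n) p q t + \<eta> * (v \<bullet> v)"
          by (simp add: mult.commute[of \<eta>])
      qed
      also have "\<dots> = v \<bullet> (F A0 A D (?K n) t *v v) + \<epsilon> * (v \<bullet> v)"
        by (simp add: quadratic_form_entries F_component[OF kantorovich_vec_Linf t] sum.distrib
            \<eta>_def power2_eq_square)
      finally show ?thesis by simp
    qed
    then show "F A0 A D (?K n) t \<succeq> 0"
      unfolding loewner_ge_0_iff loewner_ge_scaled_mat_1_iff
      using transpose_F[OF sym kantorovich_vec_Linf t] by simp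
  qed
qed

section \<open>Convex combinations and the objective\<close>

lemma Linf_convex_combination:
  assumes "x \<in> Linf" "y \<in> Linf"
  shows "(\<lambda>t. a *\<^sub>R x t + b *\<^sub>R y t) \<in> Linf"
  using assms
  by (intro LinfI) (auto intro!: bounded_measurable_add bounded_measurable_cmult Linf_component)

lemma F_convex_combination:
  assumes x: "x \<in> Linf" and y: "y \<in> Linf" and t: "t \<in> {0..1}"
  shows "F A0 A D (\<lambda>t. (1 - l) *\<^sub>R x t + l *\<^sub>R y t) t = (1 - l) *\<^sub>R F A0 A D x t + l *\<^sub>R F A0 A D y t"
proof -
  have v: "volterra P (\<lambda>s. (1 - l) * x s $ i + l * y s $ i) t
      = (1 - l) * volterra P (\<lambda>s. x s $ i) t + l * volterra P (\<lambda>s. y s $ i) t" for P i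
    using t by (simp add: volterra_add volterra_cmult bounded_measurable_cmult Linf_component x y)
  have "F_entry A0 A D (\<lambda>t. (1 - l) *\<^sub>R x t + l *\<^sub>R y t) p q t
      = (1 - l) * F_entry A0 A D x p q t + l * F_entry A0 A D y p q t" for p q
  proof -
    have "(\<Sum>i\<in>UNIV. ((1 - l) * x t $ i + l * y t $ i) * poly (A i $ p $ q) t)
        = (1 - l) * (\<Sum>i\<in>UNIV. x t $ i * poly (A i $ p $ q) t)
          + l * (\<Sum>i\<in>UNIV. y t $ i * poly (A i $ p $ q) t)"
      by (simp only: distrib_right sum.distrib sum_distrib_left mult.assoc)
    moreover have "(\<Sum>i\<in>UNIV. volterra (D i $ p $ q) (\<lambda>s. (1 - l) * x s $ i + l * y s $ i) t)
        = (1 - l) * (\<Sum>i\<in>UNIV. volterra (D i $ p $ q) (\<lambda>s. x s $ i) t)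
          + l * (\<Sum>i\<in>UNIV. volterra (D i $ p $ q) (\<lambda>s. y s $ i) t)"
      by (simp only: v sum.distrib sum_distrib_left)
    ultimately show ?thesis
      by (simp only: F_entry_def vector_add_component vector_scaleR_component real_scaleR_def)
         (simp only: algebra_simps)
  qed
  then show ?thesis
    using x y t by (simp add: vec_eq_iff F_component Linf_convex_combination)
qed

lemma objective_eq_sum_integrals:
  assumes "x \<in> Linf"
  shows "objective c x = (\<Sum>i\<in>UNIV. integral {0..1} (\<lambda>t. x t $ i * poly (c $ i) t))"
proof -
  have m: "bounded_measurable (\<lambda>t. x t $ i * poly (c $ i) t)" for i
    by (intro bounded_measurable_mult Linf_component assms bounded_measurable_continuous continuous_intros)
  have eq: "(\<lambda>t. (\<chi> i. poly (c $ i) t) \<bullet> x t) = (\<lambda>t. \<Sum>i\<in>UNIV. x t $ i * poly (c $ i) t)"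
    by (simp add: inner_vec_def mult.commute)
  have "objective c x = integral {0..1} (\<lambda>t. \<Sum>i\<in>UNIV. x t $ i * poly (c $ i) t)"
    unfolding objective_def eq
    by (intro set_lebesgue_integral_eq_integral(2) bounded_measurable_absolutely_integrable
          bounded_measurable_sum m order_refl)
  also have "\<dots> = (\<Sum>i\<in>UNIV. integral {0..1} (\<lambda>t. x t $ i * poly (c $ i) t))"
    by (intro Henstock_Kurzweil_Integration.integral_sum bounded_measurable_integrable m) auto
  finally show ?thesis .
qed

lemma objective_linear:
  assumes x: "x \<in> Linf" and y: "y \<in> Linf"
  shows "objective c (\<lambda>t. a *\<^sub>R x t + b *\<^sub>R y t) = a * objective c x + b * objective c y"
proof -
  have i: "(\<lambda>t. r * (z t $ i * poly (c $ i) t)) integrable_on {0..1}" if "z \<in> Linf" for z i r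
    by (intro bounded_measurable_integrable bounded_measurable_cmult bounded_measurable_mult
          Linf_component that bounded_measurable_continuous continuous_intros order_refl)
  have "integral {0..1} (\<lambda>t. (a * x t $ i + b * y t $ i) * poly (c $ i) t)
      = a * integral {0..1} (\<lambda>t. x t $ i * poly (c $ i) t)
        + b * integral {0..1} (\<lambda>t. y t $ i * poly (c $ i) t)" for i
    using Henstock_Kurzweil_Integration.integral_add[OF i[OF x, of a i] i[OF y, of b i]]
    by (simp add: distrib_right mult.assoc)
  then show ?thesis
    by (simp add: objective_eq_sum_integrals x y Linf_convex_combination sum.distrib sum_distrib_left)
qed

lemma objective_kantorovich_vec_tendsto:
  assumes x: "x \<in> Linf"
  shows "(\<lambda>n. objective c (kantorovich_vec n x)) \<longlonglongrightarrow> objective c x"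
proof -
  let ?I = "\<lambda>y i. integral {0..1} (\<lambda>t. y t $ i * poly (c $ i) t)"
  have "(\<lambda>n. ?I (kantorovich_vec n x) i) \<longlonglongrightarrow> ?I x i" for i
  proof -
    let ?f = "\<lambda>s. x s $ i"
    note f = Linf_component[OF x, of i]
    have w: "continuous_on {0..1} (poly (c $ i))" by (intro continuous_intros)
    obtain C where C: "\<And>s. s \<in> {0..1} \<Longrightarrow> \<bar>poly (c $ i) s\<bar> \<le> C"
      using bounded_measurable_boundE[OF bounded_measurable_continuous[OF w]] by blast
    have int: "(\<lambda>t. h t * poly (c $ i) t) integrable_on {0..1}" if "bounded_measurable h" for h
      by (intro bounded_measurable_integrable bounded_measurable_mult that
            bounded_measurable_continuous w order_refl)
    have "norm (?I (kantorovich_vec n x) i - ?I x i)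
        \<le> C * integral {0..1} (\<lambda>s. \<bar>kantorovich n ?f s - ?f s\<bar>)" for n
    proof -
      have "?I (kantorovich_vec n x) i - ?I x i
          = integral {0..1} (\<lambda>t. (kantorovich n ?f t - ?f t) * poly (c $ i) t)"
        unfolding kantorovich_vec_def
        by (simp add: left_diff_distrib Henstock_Kurzweil_Integration.integral_diff int
            bounded_measurable_kantorovich f)
      then show ?thesis
        using abs_weighted_integral_le[OF bounded_measurable_diff[OF bounded_measurable_kantorovich f] w C, of 1]
        by simp
    qed
    then have "\<forall>\<^sub>F n in sequentially. norm (?I (kantorovich_vec n x) i - ?I x i)
        \<le> C * integral {0..1} (\<lambda>s. \<bar>kantorovich n ?f s - ?f s\<bar>)"
      by (intro always_eventually allI)
    moreover have "(\<lambda>n. C * integral {0..1} (\<lambda>s. \<bar>kantorovich n ?f s - ?f s\<bar>)) \<longlonglongrightarrow> 0"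
      using tendsto_mult_left[OF kantorovich_L1_tendsto[OF f], of C] by simp
    ultimately have "(\<lambda>n. ?I (kantorovich_vec n x) i - ?I x i) \<longlonglongrightarrow> 0"
      by (rule Lim_null_comparison)
    then show ?thesis by (simp add: LIM_zero_iff)
  qed
  then show ?thesis
    unfolding objective_eq_sum_integrals[OF x] objective_eq_sum_integrals[OF kantorovich_vec_Linf]
    by (intro tendsto_sum)
qed

section \<open>Density of polynomial solutions\<close>

definition polynomial_feasible :: "real poly^'m^'m \<Rightarrow> ('n::finite \<Rightarrow> real poly^'m^'m)
    \<Rightarrow> ('n \<Rightarrow> real poly poly^'m^'m) \<Rightarrow> (real \<Rightarrow> real^'n) set" where
  "polynomial_feasible A0 A D =
     {x \<in> feasible A0 A D. \<forall>i. \<exists>p. \<forall>t\<in>{0..1}. x t $ i = poly p t}"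

text \<open>Moving a feasible point slightly towards the strictly feasible one costs little in the objective
and gives the positive margin that smoothing consumes.\<close>
lemma feasible_objective_approx_by_polynomials:
  fixes A0 :: "real poly^'m^'m"
  assumes sym: "transpose A0 = A0" "\<And>i. transpose (A i) = A i" "\<And>i. transpose (D i) = D i"
    and strict: "strictly_feasible A0 A D"
    and x: "x \<in> feasible A0 A D" and "r < objective c x"
  shows "\<exists>y\<in>polynomial_feasible A0 A D. r < objective c y"
proof -
  obtain z \<epsilon> where z: "z \<in> Linf" "\<epsilon> > 0" "AE t in lebesgue_on {0..1}. F A0 A D z t \<succeq> \<epsilon> *\<^sub>R mat 1"
    using strict by (auto simp: strictly_feasible_def)
  have xL: "x \<in> Linf" and xF: "AE t in lebesgue_on {0..1}. F A0 A D x t \<succeq> 0"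
    using x by (auto simp: feasible_def)
  let ?y = "\<lambda>l t. (1 - l) *\<^sub>R x t + l *\<^sub>R z t"
  have "((\<lambda>l. objective c (?y l)) \<longlongrightarrow> (1 - 0) * objective c x + 0 * objective c z) (at_right 0)"
    unfolding objective_linear[OF xL z(1)] by (intro tendsto_intros)
  then have "\<forall>\<^sub>F l in at_right 0. r < objective c (?y l)"
    using \<open>r < objective c x\<close> by (intro order_tendstoD) auto
  moreover have "\<forall>\<^sub>F l in at_right (0::real). 0 < l \<and> l < 1"
    by (rule eventually_at_rightI[of 0 1]) auto
  ultimately obtain l where l: "0 < l" "l < 1" "r < objective c (?y l)"
    using eventually_happens'[OF trivial_limit_at_right_real eventually_conj] by blast
  have yL: "?y l \<in> Linf" by (rule Linf_convex_combination[OF xL z(1)])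
  have "AE t in lebesgue_on {0..1}. F A0 A D (?y l) t \<succeq> (l * \<epsilon>) *\<^sub>R mat 1"
    using AE_space xF z(3)
  proof eventually_elim
    case (elim t)
    then show ?case
      using F_convex_combination[OF xL z(1), of t A0 A D l]
        loewner_ge_convex_combination[OF elim(2,3), of l] l(1,2)
      by simp
  qed
  then have "\<forall>\<^sub>F n in sequentially. \<forall>t\<in>{0..1}. F A0 A D (kantorovich_vec n (?y l)) t \<succeq> 0"
    using l(1) z(2) by (intro polynomial_strict_approximation sym yL) auto
  moreover have "\<forall>\<^sub>F n in sequentially. r < objective c (kantorovich_vec n (?y l))"
    using objective_kantorovich_vec_tendsto[OF yL] l(3) by (rule order_tendstoD)
  ultimately obtain n where n: "\<forall>t\<in>{0..1}. F A0 A D (kantorovich_vec n (?y l)) t \<succeq> 0"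
    "r < objective c (kantorovich_vec n (?y l))"
    using eventually_happens'[OF sequentially_bot eventually_conj] by blast
  have "kantorovich_vec n (?y l) \<in> polynomial_feasible A0 A D"
  proof -
    have "AE t in lebesgue_on {0..1}. F A0 A D (kantorovich_vec n (?y l)) t \<succeq> 0"
      using n(1) by (intro AE_I2) simp
    moreover have "\<exists>p. \<forall>t\<in>{0..1}. kantorovich_vec n (?y l) t $ i = poly p t" for i
      using kantorovich_polynomial[of n "\<lambda>s. ?y l s $ i"] by (auto simp: kantorovich_vec_def)
    ultimately show ?thesis
      by (simp add: polynomial_feasible_def feasible_def kantorovich_vec_Linf)
  qed
  with n(2) show ?thesis by blast
qed

theorem theorem4:
  fixes c :: "real poly^'n"
    and A0 :: "real poly^'m^'m"
    and A :: "'n \<Rightarrow> real poly^'m^'m"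
    and D :: "'n \<Rightarrow> real poly poly^'m^'m"
  assumes "transpose A0 = A0"
    and "\<And>i. transpose (A i) = A i"
    and "\<And>i. transpose (D i) = D i"
    and "strictly_feasible A0 A D"
  shows "\<exists>x :: nat \<Rightarrow> real \<Rightarrow> real^'n.
           (\<forall>k. x k \<in> feasible A0 A D) \<and>
           (\<forall>k i. \<exists>p. \<forall>t\<in>{0..1}. x k t $ i = poly p t) \<and>
           (\<lambda>k. ereal (objective c (x k))) \<longlonglongrightarrow> opt c A0 A D"
proof -
  let ?P = "polynomial_feasible A0 A D" and ?obj = "\<lambda>x. ereal (objective c x)"
  have approx: "\<exists>y\<in>?P. r < objective c y" if "x \<in> feasible A0 A D" "r < objective c x" for x r
    using feasible_objective_approx_by_polynomials[OF assms that] .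
  obtain z \<epsilon> where z: "z \<in> Linf" "\<epsilon> > 0" "AE t in lebesgue_on {0..1}. F A0 A D z t \<succeq> \<epsilon> *\<^sub>R mat 1"
    using assms(4) by (auto simp: strictly_feasible_def)
  have "AE t in lebesgue_on {0..1}. F A0 A D z t \<succeq> 0"
    using z(3)
  proof eventually_elim
    case (elim t)
    then show ?case
      unfolding loewner_ge_0_iff loewner_ge_scaled_mat_1_iff
      using z(2) by (auto intro: order_trans[rotated])
  qed
  then have "z \<in> feasible A0 A D" using z(1) by (simp add: feasible_def)
  then have nonempty: "?P \<noteq> {}" using approx[of z "objective c z - 1"] by auto
  \<comment> \<open>Written as a supremum over polynomial solutions only, the value is the limit of an increasing sequence attained by such solutions; this covers an infinite value too.\<close>
  have "opt c A0 A D = (SUP x\<in>?P. ?obj x)"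
  proof (rule antisym)
    show "opt c A0 A D \<le> (SUP x\<in>?P. ?obj x)"
      unfolding opt_def
    proof (rule SUP_least, rule ccontr)
      fix x assume x: "x \<in> feasible A0 A D" and "\<not> ?obj x \<le> (SUP x\<in>?P. ?obj x)"
      then obtain r where r: "(SUP x\<in>?P. ?obj x) < ereal r" "r < objective c x"
        using ereal_dense2[of "SUP x\<in>?P. ?obj x" "?obj x"] by (auto simp: not_le)
      then obtain y where "y \<in> ?P" "r < objective c y" using approx[OF x] by blast
      then have "ereal r < (SUP x\<in>?P. ?obj x)" by (subst less_SUP_iff) auto
      with r(1) show False by simp
    qed
    show "(SUP x\<in>?P. ?obj x) \<le> opt c A0 A D"
      unfolding opt_def by (rule SUP_subset_mono) (auto simp: polynomial_feasible_def)
  qed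
  moreover obtain f :: "nat \<Rightarrow> ereal" where f: "incseq f" "range f \<subseteq> ?obj ` ?P"
    and "(SUP x\<in>?P. ?obj x) = (SUP k. f k)"
    using Sup_countable_SUP[of "?obj ` ?P"] nonempty by auto
  ultimately have lim: "f \<longlonglongrightarrow> opt c A0 A D" using LIMSEQ_SUP[OF f(1)] by simp
  have "\<forall>k. \<exists>x. x \<in> ?P \<and> f k = ?obj x" using f(2) by blast
  then obtain x where x: "\<And>k. x k \<in> ?P" "\<And>k. f k = ?obj (x k)" by metis
  have "(\<lambda>k. ?obj (x k)) \<longlonglongrightarrow> opt c A0 A D" using lim by (simp add: x(2)[symmetric])
  then show ?thesis
    using x(1) unfolding polynomial_feasible_def by (intro exI[of _ x]) auto
qed

end
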